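(* There exist a prime power $q$, positive integers $n$ and $t$ with $t\mid n$ and $1<t<n$, and an R-$q^t$-partially scattered polynomial $f\in\mathcal{L}_{n,q}$ such that $(\mathbb{S}_f,+,\cdot)$ is not a field.
   Context: $\mathcal{L}_{n,q}$ is the set of $q$-polynomials $\sum_{i=0}^{n-1}a_ix^{q^i}$ with $a_i\in\mathbb{F}_{q^n}$, identified with the $\mathbb{F}_q$-linear endomorphisms of $\mathbb{F}_{q^n}$. The polynomial $f$ is R-$q^t$-partially scattered if for all $y,z\in\mathbb{F}_{q^n}^*$, $\frac{f(y)}{y}=\frac{f(z)}{z}$ and $\frac{y}{z}\in\mathbb{F}_{q^t}$ imply $\frac{y}{z}\in\mathbb{F}_q$. The graph of $f$ is $\mathcal{G}_f=\{(y,f(y)) : y\in\mathbb{F}_{q^n}\}$, and $\mathbb{S}_f=\{A\in\mathbb{F}_{q^n}^{2\times2} : A\mathcal{G}_f\subseteq\mathcal{G}_f\}$ with $A\mathcal{G}_f=\left\{A\begin{pmatrix}y\\ f(y)\end{pmatrix} : y\in\mathbb{F}_{q^n}\right\}$, equipped with the usual matrix sum and product. *)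

theory Defs
  imports "HOL-Number_Theory.Prime_Powers" "HOL-Algebra.Subrings" "HOL-Algebra.Multiplicative_Group"
begin

text \<open>
  In the field \<open>K\<close> with \<open>q ^ n\<close> elements, a subfield is determined by its cardinality \<open>m\<close>, and
  one with \<open>m = q ^ t\<close> elements exists for every positive divisor \<open>t\<close> of \<open>n\<close>.
\<close>

definition subfield_of_order :: "('a, 'b) ring_scheme \<Rightarrow> nat \<Rightarrow> 'a set" where
  "subfield_of_order K m = (THE F. subfield F K \<and> card F = m)"

lemma subfield_of_order_card:
  assumes "field K" "finite (carrier K)" "subfield F K"
  shows "subfield_of_order K (card F) = F"
proof -
  interpret field K by fact
  have eq: "G - {\<zero>\<^bsub>K\<^esub>} = {x \<in> carrier K. x [^]\<^bsub>K\<^esub> (card G - 1) = \<one>\<^bsub>K\<^esub>}"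
    if G: "subfield G K" for G
  proof -
    have sub: "G \<subseteq> carrier K" and z: "\<zero>\<^bsub>K\<^esub> \<in> G" and o: "\<one>\<^bsub>K\<^esub> \<in> G"
      using subfieldE(3)[OF G] subringE(2,3)[OF subfieldE(1)[OF G]] by auto
    have fin: "finite G" using sub assms(2) finite_subset by blast
    have c: "card (G - {\<zero>\<^bsub>K\<^esub>}) = card G - 1" using z fin by simp
    have pos: "card G - 1 \<noteq> 0" using o fin c by (metis Diff_iff card_0_eq empty_iff finite_Diff singletonD zero_not_one)
    interpret G: field "K\<lparr>carrier := G\<rparr>" using subfield_iff(2)[OF G] .
    have "x [^]\<^bsub>K\<^esub> (card G - 1) = \<one>\<^bsub>K\<^esub>" if x: "x \<in> G - {\<zero>\<^bsub>K\<^esub>}" for x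
    proof -
      interpret M: group "mult_of (K\<lparr>carrier := G\<rparr>)" by (rule G.field_mult_group)
      have "x [^]\<^bsub>mult_of (K\<lparr>carrier := G\<rparr>)\<^esub> order (mult_of (K\<lparr>carrier := G\<rparr>))
          = \<one>\<^bsub>mult_of (K\<lparr>carrier := G\<rparr>)\<^esub>"
        by (rule M.pow_order_eq_1) (use x in simp)
      then show ?thesis
        by (simp add: order_def c nat_pow_mult_of[symmetric] nat_pow_def)
    qed
    then have "G - {\<zero>\<^bsub>K\<^esub>} \<subseteq> {x \<in> carrier K. x [^]\<^bsub>K\<^esub> (card G - 1) = \<one>\<^bsub>K\<^esub>}"
      using sub by auto
    moreover have "card {x \<in> carrier K. x [^]\<^bsub>K\<^esub> (card G - 1) = \<one>\<^bsub>K\<^esub>} \<le> card (G - {\<zero>\<^bsub>K\<^esub>})"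
      using num_roots_le_deg[OF assms(2) pos] c by simp
    ultimately show ?thesis using assms(2) by (intro card_seteq) auto
  qed
  have "G = F" if "subfield G K" "card G = card F" for G
    using eq[OF that(1)] eq[OF assms(3)] that(2)
      subringE(2)[OF subfieldE(1)[OF that(1)]] subringE(2)[OF subfieldE(1)[OF assms(3)]]
    by (metis insert_Diff)
  then show ?thesis unfolding subfield_of_order_def using assms(3) by (intro the_equality) auto
qed

text \<open>The \<open>q\<close>-polynomials, identified with the maps that they induce on \<open>carrier K\<close>.\<close>

definition q_polynomials :: "('a, 'b) ring_scheme \<Rightarrow> nat \<Rightarrow> nat \<Rightarrow> ('a \<Rightarrow> 'a) set" where
  "q_polynomials K q n =
     {\<lambda>x \<in> carrier K. \<Oplus>\<^bsub>K\<^esub> i \<in> {..<n}. a i \<otimes>\<^bsub>K\<^esub> x [^]\<^bsub>K\<^esub> (q ^ i) | a. a \<in> {..<n} \<rightarrow> carrier K}"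

definition R_partially_scattered :: "('a, 'b) ring_scheme \<Rightarrow> nat \<Rightarrow> nat \<Rightarrow> ('a \<Rightarrow> 'a) \<Rightarrow> bool" where
  "R_partially_scattered K q t f \<longleftrightarrow>
     (\<forall>y \<in> carrier K - {\<zero>\<^bsub>K\<^esub>}. \<forall>z \<in> carrier K - {\<zero>\<^bsub>K\<^esub>}.
        f y \<otimes>\<^bsub>K\<^esub> inv\<^bsub>K\<^esub> y = f z \<otimes>\<^bsub>K\<^esub> inv\<^bsub>K\<^esub> z \<and>
        y \<otimes>\<^bsub>K\<^esub> inv\<^bsub>K\<^esub> z \<in> subfield_of_order K (q ^ t) \<longrightarrow>
        y \<otimes>\<^bsub>K\<^esub> inv\<^bsub>K\<^esub> z \<in> subfield_of_order K q)"

text \<open>A \<open>2 \<times> 2\<close> matrix is the pair of its rows.\<close>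

type_synonym 'a mat2 = "('a \<times> 'a) \<times> ('a \<times> 'a)"

definition mat2_ring :: "('a, 'b) ring_scheme \<Rightarrow> 'a mat2 ring" where
  "mat2_ring K =
     \<lparr>carrier = (carrier K \<times> carrier K) \<times> (carrier K \<times> carrier K),
      mult = (\<lambda>((a, b), (c, d)) ((a', b'), (c', d')).
        ((a \<otimes>\<^bsub>K\<^esub> a' \<oplus>\<^bsub>K\<^esub> b \<otimes>\<^bsub>K\<^esub> c', a \<otimes>\<^bsub>K\<^esub> b' \<oplus>\<^bsub>K\<^esub> b \<otimes>\<^bsub>K\<^esub> d'),
         (c \<otimes>\<^bsub>K\<^esub> a' \<oplus>\<^bsub>K\<^esub> d \<otimes>\<^bsub>K\<^esub> c', c \<otimes>\<^bsub>K\<^esub> b' \<oplus>\<^bsub>K\<^esub> d \<otimes>\<^bsub>K\<^esub> d'))),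
      one = ((\<one>\<^bsub>K\<^esub>, \<zero>\<^bsub>K\<^esub>), (\<zero>\<^bsub>K\<^esub>, \<one>\<^bsub>K\<^esub>)),
      zero = ((\<zero>\<^bsub>K\<^esub>, \<zero>\<^bsub>K\<^esub>), (\<zero>\<^bsub>K\<^esub>, \<zero>\<^bsub>K\<^esub>)),
      add = (\<lambda>((a, b), (c, d)) ((a', b'), (c', d')).
        ((a \<oplus>\<^bsub>K\<^esub> a', b \<oplus>\<^bsub>K\<^esub> b'), (c \<oplus>\<^bsub>K\<^esub> c', d \<oplus>\<^bsub>K\<^esub> d')))\<rparr>"

lemma ring_mat2_ring:
  assumes "cring K"
  shows "ring (mat2_ring K)"
proof -
  interpret cring K by fact
  show ?thesis
  proof (rule ringI)
    show "abelian_group (mat2_ring K)"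
    proof (rule abelian_groupI)
      fix x assume "x \<in> carrier (mat2_ring K)"
      then obtain a b c d where "x = ((a, b), (c, d))" "a \<in> carrier K" "b \<in> carrier K"
        "c \<in> carrier K" "d \<in> carrier K" by (auto simp: mat2_ring_def)
      then show "\<exists>y \<in> carrier (mat2_ring K). y \<oplus>\<^bsub>mat2_ring K\<^esub> x = \<zero>\<^bsub>mat2_ring K\<^esub>"
        by (intro bexI[of _ "((\<ominus>\<^bsub>K\<^esub> a, \<ominus>\<^bsub>K\<^esub> b), (\<ominus>\<^bsub>K\<^esub> c, \<ominus>\<^bsub>K\<^esub> d))"])
          (auto simp: mat2_ring_def l_neg)
    qed (auto simp: mat2_ring_def a_ac)
    show "monoid (mat2_ring K)"
      by (rule monoidI) (auto simp: mat2_ring_def l_distr r_distr m_assoc a_ac)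
  qed (auto simp: mat2_ring_def l_distr r_distr a_ac)
qed

definition mat2_vec :: "('a, 'b) ring_scheme \<Rightarrow> 'a mat2 \<Rightarrow> 'a \<times> 'a \<Rightarrow> 'a \<times> 'a" where
  "mat2_vec K = (\<lambda>((a, b), (c, d)) (u, v).
     (a \<otimes>\<^bsub>K\<^esub> u \<oplus>\<^bsub>K\<^esub> b \<otimes>\<^bsub>K\<^esub> v, c \<otimes>\<^bsub>K\<^esub> u \<oplus>\<^bsub>K\<^esub> d \<otimes>\<^bsub>K\<^esub> v))"

definition graph_of :: "('a, 'b) ring_scheme \<Rightarrow> ('a \<Rightarrow> 'a) \<Rightarrow> ('a \<times> 'a) set" where
  "graph_of K f = {(y, f y) | y. y \<in> carrier K}"

definition graph_stabilizer :: "('a, 'b) ring_scheme \<Rightarrow> ('a \<Rightarrow> 'a) \<Rightarrow> 'a mat2 set" where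
  "graph_stabilizer K f =
     {A \<in> carrier (mat2_ring K). mat2_vec K A ` graph_of K f \<subseteq> graph_of K f}"

definition graph_stabilizer_ring :: "('a, 'b) ring_scheme \<Rightarrow> ('a \<Rightarrow> 'a) \<Rightarrow> 'a mat2 ring" where
  "graph_stabilizer_ring K f = (mat2_ring K)\<lparr>carrier := graph_stabilizer K f\<rparr>"

end

theory Submission
  imports Defs
begin

text \<open>
  Let \<open>W\<close> be a two-dimensional \<open>\<bbbF>\<^sub>2\<close>-subspace of \<open>\<bbbF>\<^sub>1\<^sub>6\<close> containing no pair \<open>w, \<lambda>w\<close> with \<open>w \<noteq> 0\<close> and
  \<open>\<lambda> \<in> \<bbbF>\<^sub>4 - \<bbbF>\<^sub>2\<close>, and let \<open>f\<close> be \<open>\<bbbF>\<^sub>2\<close>-linear with kernel and image \<open>W\<close>. If \<open>f (\<lambda>y) = \<lambda> f y\<close> with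
  \<open>y \<noteq> 0\<close>, then \<open>W\<close> contains \<open>f y, \<lambda> f y\<close>, so \<open>f y = 0\<close> and \<open>W\<close> contains \<open>y, \<lambda>y\<close>, a contradiction; hence
  \<open>f\<close> is partially scattered for \<open>q = 2\<close>, \<open>n = 4\<close>, \<open>t = 2\<close>. As \<open>f \<circ> f = 0\<close>, the nilpotent matrix
  \<open>((0, 1), (0, 0))\<close> maps \<open>(y, f y)\<close> to \<open>(f y, 0) = (f y, f (f y))\<close>, so it stabilizes the graph.

  We take \<open>\<bbbF>\<^sub>1\<^sub>6 = \<bbbF>\<^sub>2[u]/(u\<^sup>4 + u + 1)\<close> and \<open>W = {0, 1, u, u + 1}\<close>. The bits of a number below 16 are the
  coordinates in the basis \<open>1, u, u\<^sup>2, u\<^sup>3\<close>, and \<open>f x = x div 4\<close>, which is \<open>(u\<^sup>2 + u) x\<^sup>2 + x\<^sup>4 + (u\<^sup>2 + u + 1) x\<^sup>8\<close>; \<open>gf16_shift\<close> is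
  multiplication by \<open>u\<close>, and \<open>gf16_mult\<close> is Horner's scheme in \<open>u\<close>.
\<close>

section \<open>Arithmetic modulo \<open>u^4 + u + 1\<close>, the polynomial with bit pattern
  19\<close>

definition gf16_shift :: "nat \<Rightarrow> nat" where
  "gf16_shift a = (if a < 8 then 2 * a else xor (2 * a) 19)"

fun gf16_mult :: "nat \<Rightarrow> nat \<Rightarrow> nat" where
  "gf16_mult a b =
     (if b = 0 then 0 else xor (if odd b then a else 0) (gf16_shift (gf16_mult a (b div 2))))"

declare gf16_mult.simps [simp del]

definition gf16 :: "nat ring" where
  "gf16 = \<lparr>carrier = {..<16}, mult = gf16_mult, one = 1, zero = 0, add = xor\<rparr>"

(* The simplifier evaluates xor 16 19 to Suc (Suc (Suc 0)), on which the bit rules get stuck. *)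
lemmas gf16_eval = gf16_shift_def numeral_3_eq_3 [symmetric]

lemma carrier_gf16: "carrier gf16 = {..<16}"
  by (simp add: gf16_def)

text \<open>Splits a claim about all field elements into 16 ground instances that rewriting can
  evaluate; unfolding it under two quantifiers covers all pairs.\<close>

lemma all_less_16:
  "(\<forall>a<16::nat. P a) \<longleftrightarrow> P 0 \<and> P 1 \<and> P 2 \<and> P 3 \<and> P 4 \<and> P 5 \<and> P 6 \<and> P 7 \<and>
     P 8 \<and> P 9 \<and> P 10 \<and> P 11 \<and> P 12 \<and> P 13 \<and> P 14 \<and> P 15"
  by (simp add: eval_nat_numeral All_less_Suc conj_ac)

lemma xor_less_16:
  fixes a b :: nat
  assumes "a < 16" "b < 16"
  shows "xor a b < 16"
proof -
  have "\<forall>a<16::nat. \<forall>b<16. xor a b < 16"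
    unfolding all_less_16 by simp
  then show ?thesis using assms by blast
qed

lemma gf16_shift_0 [simp]: "gf16_shift 0 = 0"
  by (simp add: gf16_shift_def)

lemma gf16_shift_less: "a < 16 \<Longrightarrow> gf16_shift a < 16"
proof -
  have "\<forall>a<16. gf16_shift a < 16"
    unfolding all_less_16 by (simp add: gf16_eval)
  then show "a < 16 \<Longrightarrow> gf16_shift a < 16" by blast
qed

lemma gf16_shift_xor:
  assumes "a < 16" "b < 16"
  shows "gf16_shift (xor a b) = xor (gf16_shift a) (gf16_shift b)"
proof -
  have "\<forall>a<16. \<forall>b<16. gf16_shift (xor a b) = xor (gf16_shift a) (gf16_shift b)"
    unfolding all_less_16 by (simp add: gf16_eval)
  then show ?thesis using assms by blast
qed

text \<open>Horner's recursion along the binary digits of a literal second factor, so that rewriting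
  computes concrete products.\<close>

lemma gf16_mult_numeral [simp]:
  "gf16_mult a 0 = 0"
  "gf16_mult a (Suc 0) = a"
  "gf16_mult a (numeral (num.Bit0 w)) = gf16_shift (gf16_mult a (numeral w))"
  "gf16_mult a (numeral (num.Bit1 w)) = xor a (gf16_shift (gf16_mult a (numeral w)))"
  "gf16_mult a (numeral num.One) = a"
  by (simp_all add: gf16_mult.simps[of a 0] gf16_mult.simps[of a "Suc 0"]
      gf16_mult.simps[of a "numeral (num.Bit0 w)"] gf16_mult.simps[of a "numeral (num.Bit1 w)"]
      gf16_shift_def)

lemma gf16_mult_less: "a < 16 \<Longrightarrow> gf16_mult a b < 16"
  by (induction a b rule: gf16_mult.induct)
    (subst gf16_mult.simps, simp add: xor_less_16 gf16_shift_less)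

text \<open>The recursion treats the factors asymmetrically. Once symmetry is checked on all pairs,
  each law for the right factor follows from its left counterpart.\<close>

lemma gf16_mult_commute:
  assumes "a < 16" "b < 16"
  shows "gf16_mult a b = gf16_mult b a"
proof -
  have "\<forall>a<16. \<forall>b<16. gf16_mult a b = gf16_mult b a"
    unfolding all_less_16 by (simp add: gf16_eval)
  then show ?thesis using assms by blast
qed

lemma gf16_mult_xor_left:
  assumes "a < 16" "b < 16"
  shows "gf16_mult (xor a b) c = xor (gf16_mult a c) (gf16_mult b c)"
proof (induction c rule: less_induct)
  case (less c)
  show ?case
  proof (cases "c = 0")
    case False
    then have "gf16_mult (xor a b) (c div 2) = xor (gf16_mult a (c div 2)) (gf16_mult b (c div 2))"
      by (intro less.IH) simp
    then show ?thesis
      using False assms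
      by (simp add: gf16_mult.simps[of _ c] gf16_shift_xor gf16_mult_less ac_simps)
  qed simp
qed

lemma gf16_mult_xor_right:
  assumes "a < 16" "b < 16" "c < 16"
  shows "gf16_mult c (xor a b) = xor (gf16_mult c a) (gf16_mult c b)"
  using assms gf16_mult_xor_left[of a b c] by (simp add: gf16_mult_commute xor_less_16)

lemma gf16_mult_shift_left:
  assumes "a < 16"
  shows "gf16_mult (gf16_shift a) b = gf16_shift (gf16_mult a b)"
proof (induction b rule: less_induct)
  case (less b)
  show ?case
  proof (cases "b = 0")
    case False
    then have "gf16_mult (gf16_shift a) (b div 2) = gf16_shift (gf16_mult a (b div 2))"
      by (intro less.IH) simp
    then show ?thesis
      using False assms
      by (simp add: gf16_mult.simps[of _ b] gf16_shift_xor gf16_shift_less gf16_mult_less)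
  qed (simp add: gf16_shift_def)
qed

lemma gf16_mult_shift_right:
  assumes "a < 16" "b < 16"
  shows "gf16_mult a (gf16_shift b) = gf16_shift (gf16_mult a b)"
  using assms gf16_mult_shift_left[of b a] by (simp add: gf16_mult_commute gf16_shift_less)

text \<open>Induction over the bits of \<open>c\<close> replaces a check of 4096 triples:
  multiplication by a fixed element is additive and commutes with multiplication by
  \<open>u\<close>.\<close>

lemma gf16_mult_assoc:
  assumes "a < 16" "b < 16"
  shows "gf16_mult (gf16_mult a b) c = gf16_mult a (gf16_mult b c)"
proof (induction c rule: less_induct)
  case (less c)
  show ?case
  proof (cases "c = 0")
    case False
    then have "gf16_mult (gf16_mult a b) (c div 2) = gf16_mult a (gf16_mult b (c div 2))"
      by (intro less.IH) simp
    then show ?thesis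
      using False assms
      by (simp add: gf16_mult.simps[of _ c] gf16_mult_xor_right gf16_mult_shift_right
          gf16_shift_less gf16_mult_less)
  qed simp
qed

lemma gf16_mult_inverse_ex:
  assumes "a < 16" "a \<noteq> 0"
  shows "\<exists>b<16. gf16_mult a b = 1"
proof -
  \<comment> \<open>The inverse is \<open>a^14\<close>, because \<open>a^15 = 1\<close>: with
    \<open>s = a^2\<close> and \<open>r = a^4\<close>, it is \<open>s r^3\<close>.\<close>
  have "\<forall>a<16. a \<noteq> 0 \<longrightarrow>
    (let s = gf16_mult a a; r = gf16_mult s s in
     gf16_mult a (gf16_mult s (gf16_mult r (gf16_mult r r))) = 1)"
    unfolding all_less_16 by (simp add: gf16_eval)
  then show ?thesis using assms unfolding Let_def by (meson gf16_mult_less)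
qed

lemma cring_gf16: "cring gf16"
proof (rule cringI)
  show "abelian_group gf16"
  proof (rule abelian_groupI)
    show "\<exists>y\<in>carrier gf16. y \<oplus>\<^bsub>gf16\<^esub> x = \<zero>\<^bsub>gf16\<^esub>" if "x \<in> carrier gf16" for x
      using that by (intro bexI[of _ x]) (auto simp: gf16_def)
  qed (auto simp: gf16_def xor_less_16 ac_simps)
  show "comm_monoid gf16"
  proof (rule comm_monoidI)
    show "x \<otimes>\<^bsub>gf16\<^esub> y = y \<otimes>\<^bsub>gf16\<^esub> x" if "x \<in> carrier gf16" "y \<in> carrier gf16" for x y
      using that by (simp add: gf16_def gf16_mult_commute)
  qed (auto simp: gf16_def gf16_mult_less gf16_mult_assoc gf16_mult_commute[of "Suc 0"])
qed (auto simp: gf16_def gf16_mult_xor_left)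

lemma field_gf16: "field gf16"
  by (rule cring.cring_fieldI2[OF cring_gf16]) 
    (use gf16_mult_inverse_ex in \<open>auto simp: gf16_def Bex_def\<close>)

lemma finite_gf16: "finite (carrier gf16)"
  by (simp add: carrier_gf16)

section \<open>The subfields of orders 2 and 4\<close>

lemma subfield_of_order_gf16:
  "subfield_of_order gf16 2 = {0, 1}"
  "subfield_of_order gf16 4 = {0, 1, 6, 7}"
proof -
  interpret field gf16 by (rule field_gf16)
  have neg: "\<ominus>\<^bsub>gf16\<^esub> a = a" if "a < 16" for a
    using that by (intro minus_equality) (auto simp: gf16_def)
  \<comment> \<open>6 and 7 encode \<open>u^2 + u\<close> and \<open>u^2 + u + 1\<close>, the two
    roots of \<open>X^2 + X + 1\<close>, which together with 0 and 1 form F_4.\<close>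
  have sub: "subfield F gf16"
    if F: "F = {0, 1} \<or> F = {0, 1, 6, 7}" for F
  proof (rule subfieldI')
    show "subring F gf16"
    proof (rule subringI)
      show "F \<subseteq> carrier gf16" "\<one>\<^bsub>gf16\<^esub> \<in> F" using F by (auto simp: gf16_def)
      show "\<ominus>\<^bsub>gf16\<^esub> h \<in> F" if "h \<in> F" for h using F that by (auto simp: neg)
      show "h1 \<otimes>\<^bsub>gf16\<^esub> h2 \<in> F" "h1 \<oplus>\<^bsub>gf16\<^esub> h2 \<in> F" if "h1 \<in> F" "h2 \<in> F" for h1 h2
        using F that by (auto simp: gf16_def gf16_eval)
    qed
    show "inv\<^bsub>gf16\<^esub> k \<in> F" if "k \<in> F - {\<zero>\<^bsub>gf16\<^esub>}" for k
    proof -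
      have "\<exists>l\<in>F. l \<in> carrier gf16 \<and> k \<otimes>\<^bsub>gf16\<^esub> l = \<one>\<^bsub>gf16\<^esub>"
        using F that by (auto simp: gf16_def gf16_eval)
      moreover have "k \<in> carrier gf16" using F that by (auto simp: gf16_def)
      ultimately show ?thesis using comm_inv_char by metis
    qed
  qed
  show "subfield_of_order gf16 2 = {0, 1}" "subfield_of_order gf16 4 = {0, 1, 6, 7}"
    using subfield_of_order_card[OF field_gf16 finite_gf16 sub[of "{0, 1}"]]
      subfield_of_order_card[OF field_gf16 finite_gf16 sub[of "{0, 1, 6, 7}"]]
    by (simp_all add: eval_nat_numeral)
qed

section \<open>The partially scattered polynomial\<close>

definition gf16_div4 :: "nat \<Rightarrow> nat" where
  "gf16_div4 = (\<lambda>x\<in>{..<16}. x div 4)"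

lemma gf16_div4_q_polynomial: "gf16_div4 \<in> q_polynomials gf16 2 4"
proof -
  interpret field gf16 by (rule field_gf16)
  define a :: "nat \<Rightarrow> nat" where "a = (\<lambda>i. [0, 6, 1, 7] ! i)"
  have a: "a \<in> {..<4} \<rightarrow> carrier gf16"
    by (auto simp: a_def gf16_def eval_nat_numeral less_Suc_eq)
  have "x div 4 = (\<Oplus>\<^bsub>gf16\<^esub> i \<in> {..<4}. a i \<otimes>\<^bsub>gf16\<^esub> x [^]\<^bsub>gf16\<^esub> ((2::nat) ^ i))"
    if x: "x < 16" for x
  proof -
    have xc: "x \<in> carrier gf16" using x by (simp add: gf16_def)
    define s where "s = gf16_mult x x"
    define r where "r = gf16_mult s s"
    have less: "s < 16" "r < 16" using x by (auto simp: s_def r_def gf16_mult_less)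
    have p1: "x [^]\<^bsub>gf16\<^esub> (1::nat) = x" using xc by simp
    have p2: "x [^]\<^bsub>gf16\<^esub> (2::nat) = s"
      using xc by (simp add: numeral_2_eq_2) (simp add: gf16_def s_def)
    have p4: "x [^]\<^bsub>gf16\<^esub> (4::nat) = r"
      using nat_pow_mult[OF xc, of 2 2] by (simp add: p2) (simp add: gf16_def r_def)
    have p8: "x [^]\<^bsub>gf16\<^esub> (8::nat) = gf16_mult r r"
      using nat_pow_mult[OF xc, of 4 4] by (simp add: p4) (simp add: gf16_def)
    have set4: "{..<4::nat} = {0, 1, 2, 3}" by auto
    have "(\<Oplus>\<^bsub>gf16\<^esub> i \<in> {..<4}. a i \<otimes>\<^bsub>gf16\<^esub> x [^]\<^bsub>gf16\<^esub> ((2::nat) ^ i))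
      = a 0 \<otimes>\<^bsub>gf16\<^esub> x [^]\<^bsub>gf16\<^esub> (1::nat) \<oplus>\<^bsub>gf16\<^esub> (a 1 \<otimes>\<^bsub>gf16\<^esub> x [^]\<^bsub>gf16\<^esub> (2::nat) \<oplus>\<^bsub>gf16\<^esub>
        (a 2 \<otimes>\<^bsub>gf16\<^esub> x [^]\<^bsub>gf16\<^esub> (4::nat) \<oplus>\<^bsub>gf16\<^esub> a 3 \<otimes>\<^bsub>gf16\<^esub> x [^]\<^bsub>gf16\<^esub> (8::nat)))"
      using a xc by (subst set4) (simp add: Pi_iff)
    also have "\<dots> = xor (gf16_mult 0 x) (xor (gf16_mult 6 s) (xor (gf16_mult 1 r)
        (gf16_mult 7 (gf16_mult r r))))"
      unfolding p1 p2 p4 p8 by (simp add: a_def gf16_def)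
    also have "\<dots> = x div 4"
    proof -
      have "\<forall>x<16. xor (gf16_mult 0 x) (xor (gf16_mult 6 (gf16_mult x x))
        (xor (gf16_mult 1 (gf16_mult (gf16_mult x x) (gf16_mult x x)))
        (gf16_mult 7 (gf16_mult (gf16_mult (gf16_mult x x) (gf16_mult x x))
           (gf16_mult (gf16_mult x x) (gf16_mult x x)))))) = x div 4"
        unfolding all_less_16 by (simp add: gf16_eval)
      then show ?thesis unfolding r_def s_def using x by blast
    qed
    finally show ?thesis by simp
  qed
  then have "gf16_div4 =
    (\<lambda>x\<in>carrier gf16. \<Oplus>\<^bsub>gf16\<^esub> i \<in> {..<4}. a i \<otimes>\<^bsub>gf16\<^esub> x [^]\<^bsub>gf16\<^esub> ((2::nat) ^ i))"
    by (simp add: gf16_div4_def restrict_def fun_eq_iff carrier_gf16)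
  then show ?thesis
    unfolding q_polynomials_def using a by blast
qed

text \<open>The scalars 6 and 7 make up F_4 - F_2. The kernel and image argument gives the reason;
  the proof evaluates all 30 cases.\<close>

lemma gf16_div4_not_homogeneous:
  assumes "l \<in> {6, 7}" "z < 16" "z \<noteq> 0"
  shows "gf16_mult l z div 4 \<noteq> gf16_mult l (z div 4)"
proof -
  have "\<forall>z<16. z \<noteq> 0 \<longrightarrow> (\<forall>l\<in>{6, 7}. gf16_mult l z div 4 \<noteq> gf16_mult l (z div 4))"
    unfolding all_less_16 by (simp add: gf16_eval)
  then show ?thesis using assms by blast
qed

lemma gf16_div4_partially_scattered: "R_partially_scattered gf16 2 2 gf16_div4"
  unfolding R_partially_scattered_def
proof (intro ballI impI, elim conjE)
  interpret field gf16 by (rule field_gf16)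
  fix y z
  assume yz: "y \<in> carrier gf16 - {\<zero>\<^bsub>gf16\<^esub>}" "z \<in> carrier gf16 - {\<zero>\<^bsub>gf16\<^esub>}"
    and eq: "gf16_div4 y \<otimes>\<^bsub>gf16\<^esub> inv\<^bsub>gf16\<^esub> y = gf16_div4 z \<otimes>\<^bsub>gf16\<^esub> inv\<^bsub>gf16\<^esub> z"
    and "y \<otimes>\<^bsub>gf16\<^esub> inv\<^bsub>gf16\<^esub> z \<in> subfield_of_order gf16 (2 ^ 2)"
  define l where "l = y \<otimes>\<^bsub>gf16\<^esub> inv\<^bsub>gf16\<^esub> z"
  have l4: "l \<in> {0, 1, 6, 7}"
    using \<open>y \<otimes>\<^bsub>gf16\<^esub> inv\<^bsub>gf16\<^esub> z \<in> _\<close> by (simp add: l_def subfield_of_order_gf16)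
  have c: "y \<in> carrier gf16" "z \<in> carrier gf16" "inv\<^bsub>gf16\<^esub> y \<in> carrier gf16"
    "inv\<^bsub>gf16\<^esub> z \<in> carrier gf16" "l \<in> carrier gf16"
    using yz by (auto simp: field_Units l_def)
  have fc: "gf16_div4 y \<in> carrier gf16" "gf16_div4 z \<in> carrier gf16"
    using c by (auto simp: gf16_def gf16_div4_def)
  have inv: "inv\<^bsub>gf16\<^esub> y \<otimes>\<^bsub>gf16\<^esub> y = \<one>\<^bsub>gf16\<^esub>" "inv\<^bsub>gf16\<^esub> z \<otimes>\<^bsub>gf16\<^esub> z = \<one>\<^bsub>gf16\<^esub>"
    using yz by (auto simp: field_Units)
  have y: "y = l \<otimes>\<^bsub>gf16\<^esub> z"
    using c inv by (simp add: l_def m_assoc)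
  \<comment> \<open>Clearing denominators turns the equal quotients into
    \<open>f (l z) = l f(z)\<close>, which excludes \<open>l = 6\<close> and
    \<open>l = 7\<close>.\<close>
  have "gf16_div4 y = gf16_div4 y \<otimes>\<^bsub>gf16\<^esub> inv\<^bsub>gf16\<^esub> y \<otimes>\<^bsub>gf16\<^esub> y"
    using c fc inv by (simp add: m_assoc)
  also have "\<dots> = l \<otimes>\<^bsub>gf16\<^esub> gf16_div4 z"
    unfolding eq l_def using c fc by (simp add: m_ac)
  finally have "gf16_mult l z div 4 = gf16_mult l (z div 4)"
    using y c by (simp add: gf16_def gf16_div4_def)
  then have "l \<in> {0, 1}"
    using gf16_div4_not_homogeneous[of l z] l4 yz(2) by (auto simp: gf16_def)
  then show "y \<otimes>\<^bsub>gf16\<^esub> inv\<^bsub>gf16\<^esub> z \<in> subfield_of_order gf16 2"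
    by (simp add: l_def subfield_of_order_gf16)
qed

section \<open>A zero divisor in the stabilizer ring\<close>

lemma graph_stabilizer_ring_not_field:
  assumes "field K" "f \<in> carrier K \<rightarrow> carrier K" "\<And>y. y \<in> carrier K \<Longrightarrow> f (f y) = \<zero>\<^bsub>K\<^esub>"
  shows "\<not> field (graph_stabilizer_ring K f)"
proof
  interpret K: field K by fact
  assume "field (graph_stabilizer_ring K f)"
  then interpret S: field "graph_stabilizer_ring K f" .
  define A where "A = ((\<zero>\<^bsub>K\<^esub>, \<one>\<^bsub>K\<^esub>), (\<zero>\<^bsub>K\<^esub>, \<zero>\<^bsub>K\<^esub>))"
  have "A \<in> carrier (graph_stabilizer_ring K f)"
    using assms(2,3)
    by (auto simp: A_def graph_stabilizer_ring_def graph_stabilizer_def mat2_ring_def graph_of_def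
        mat2_vec_def Pi_iff)
  moreover have "A \<otimes>\<^bsub>graph_stabilizer_ring K f\<^esub> A = \<zero>\<^bsub>graph_stabilizer_ring K f\<^esub>"
    "A \<noteq> \<zero>\<^bsub>graph_stabilizer_ring K f\<^esub>"
    by (auto simp: A_def graph_stabilizer_ring_def mat2_ring_def)
  ultimately show False
    using S.integral by blast
qed

theorem corollary3p12:
  shows "\<exists>(q::nat) (n::nat) (t::nat) (K::nat ring) (f::nat \<Rightarrow> nat).
    primepow q \<and> 0 < n \<and> 0 < t \<and> t dvd n \<and> 1 < t \<and> t < n \<and>
    field K \<and> order K = q ^ n \<and>
    f \<in> q_polynomials K q n \<and>
    R_partially_scattered K q t f \<and>
    \<not> field (graph_stabilizer_ring K f)"
proof (intro exI conjI)
  show "primepow (2::nat)" by (intro primepow_prime) simp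
  show "\<not> field (graph_stabilizer_ring gf16 gf16_div4)"
    \<comment> \<open>Dividing twice by 4 sends every number below 16 to 0, so
      \<open>f (f y) = 0\<close>.\<close>
    by (rule graph_stabilizer_ring_not_field[OF field_gf16]) (auto simp: gf16_def gf16_div4_def)
  show "order gf16 = 2 ^ 4" by (simp add: order_def gf16_def)
qed (use field_gf16 gf16_div4_q_polynomial gf16_div4_partially_scattered in simp_all)

end
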